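(* Let $G$ be a connected graph (not necessarily finite) with vertex set $V$, with no loops and no multiple edges, and suppose that $d_G := \sup_{v\in V} d_v < \infty$, where $d_v$ is the degree of $v$. Let $N^v=\{N^v_t, t\ge 0\}$, $v\in V$, be jointly independent Poisson processes with intensity 1, and let $M^v_0$, $v \in V$, be random variables with $M^v_0\in[0,\infty)$ for every $v$, almost surely. Then there exists a unique process $\{\mathcal{M}_t, t\ge 0\}$, $\mathcal{M}_t=\{M^v_t, v\in V\}$, with initial value $\{M^v_0, v\in V\}$, which evolves according to the meteor dynamics driven by the Poisson processes $\{N^v\}_{v\in V}$.
   Context: Write $v\leftrightarrow x$ if the vertices $v$ and $x$ are connected by an edge; $d_v\geq 1$ is the number of neighbors of $v$. Meteor dynamics: $M^v_t\ge 0$ is the mass at vertex $v$ at time $t$. At the time $t$ of a jump of $N^v$ (a "meteor hit" at $v$), the mass at $v$ is distributed equally among all neighbors of $v$: $M^v$ jumps to $0$, i.e. $M^v_t=0$, and for every $x\leftrightarrow v$, $M^x_t = M^x_{t-}+M^v_{t-}/d_v$. The mass $M^v$ changes only at jump times of $N^v$ and of $N^x$ for $x\leftrightarrow v$, in the way just described, and is constant between such times. (Almost surely, no two of the Poisson processes jump at the same time.) Uniqueness means that, almost surely, the process is determined by the initial masses and the Poisson processes. *)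

theory Defs
  imports "HOL-Probability.Probability"
begin

definition poisson_process :: "'w measure \<Rightarrow> real \<Rightarrow> (real \<Rightarrow> 'w \<Rightarrow> nat) \<Rightarrow> bool" where
  "poisson_process P r N \<longleftrightarrow>
     (\<forall>t\<ge>0. N t \<in> measurable P (count_space UNIV)) \<and>
     (AE w in P. N 0 w = 0 \<and>
        mono_on {0..} (\<lambda>t. N t w) \<and>
        (\<forall>t\<ge>0. continuous (at_right t) (\<lambda>s. N s w))) \<and>
     (\<forall>s t. 0 \<le> s \<and> s < t \<longrightarrow>
        distr P (count_space UNIV) (\<lambda>w. N t w - N s w) = measure_pmf (poisson_pmf (r * (t - s)))) \<and>
     (\<forall>(n::nat) \<tau>. 0 \<le> \<tau> 0 \<and> (\<forall>i<n. \<tau> i \<le> \<tau> (Suc i)) \<longrightarrow>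
        prob_space.indep_vars P (\<lambda>_. count_space UNIV) (\<lambda>i w. N (\<tau> (Suc i)) w - N (\<tau> i) w) {..<n})"

(* Each process is regarded as one random element of the path space over [0,oo), equipped
   with the product sigma-algebra; the family may be infinite. *)
definition independent_processes ::
    "'w measure \<Rightarrow> ('v \<Rightarrow> real \<Rightarrow> 'w \<Rightarrow> nat) \<Rightarrow> 'v set \<Rightarrow> bool" where
  "independent_processes P N V \<longleftrightarrow>
     prob_space.indep_vars P (\<lambda>_. PiM {0..} (\<lambda>_. count_space UNIV))
       (\<lambda>v w. restrict (\<lambda>t. N v t w) {0..}) V"

(* For a right-continuous path, the discontinuities in (0,oo) are the left ones. *)
definition jump_times :: "(real \<Rightarrow> nat) \<Rightarrow> real set" where
  "jump_times f = {t. 0 < t \<and> \<not> continuous (at_left t) f}"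

definition left_lim :: "(real \<Rightarrow> real) \<Rightarrow> real \<Rightarrow> real" where
  "left_lim f t = Lim (at_left t) f"

(* The neighbours of v are E `` {v}.  The last clause compares m x at the two end points of
   [s, t] when no relevant jump lies in (s, t]; so m x is constant on [s, t) whenever the open
   interval (s, t) is free of relevant jumps.  Hence, if the jump times are locally finite,
   the left limits below exist. *)
definition meteor_path ::
    "'v set \<Rightarrow> 'v rel \<Rightarrow> ('v \<Rightarrow> real \<Rightarrow> nat) \<Rightarrow> ('v \<Rightarrow> real) \<Rightarrow> ('v \<Rightarrow> real \<Rightarrow> real) \<Rightarrow> bool" where
  "meteor_path V E n m0 m \<longleftrightarrow>
     (\<forall>v\<in>V. m v 0 = m0 v) \<and>
     (\<forall>v\<in>V. \<forall>t\<ge>0. 0 \<le> m v t) \<and>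
     (\<forall>v\<in>V. \<forall>t\<in>jump_times (n v).
        m v t = 0 \<and>
        (\<forall>x\<in>E `` {v}. m x t = left_lim (m x) t + left_lim (m v) t / real (card (E `` {v})))) \<and>
     (\<forall>x\<in>V. \<forall>s t. 0 \<le> s \<and> s < t \<and> (\<forall>v\<in>insert x (E `` {x}). jump_times (n v) \<inter> {s<..t} = {}) \<longrightarrow>
        m x t = m x s)"

definition meteor_process ::
    "'w measure \<Rightarrow> 'v set \<Rightarrow> 'v rel \<Rightarrow> ('v \<Rightarrow> real \<Rightarrow> 'w \<Rightarrow> nat) \<Rightarrow> ('v \<Rightarrow> 'w \<Rightarrow> real) \<Rightarrow>
       ('v \<Rightarrow> real \<Rightarrow> 'w \<Rightarrow> real) \<Rightarrow> bool" where
  "meteor_process P V E N M0 M \<longleftrightarrow>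
     (\<forall>v\<in>V. \<forall>t\<ge>0. M v t \<in> borel_measurable P) \<and>
     (AE w in P. meteor_path V E (\<lambda>v t. N v t w) (\<lambda>v. M0 v w) (\<lambda>v t. M v t w))"

end

theory Submission
  imports Defs
begin

text \<open>
  Fix a realization of the Poisson processes and trace the mass at a vertex \<open>x\<close> at time \<open>t\<close>
  backwards.  It is constant back to the last hit in the closed neighbourhood of \<open>x\<close>.  If that hit
  is at \<open>x\<close> itself, the mass just after it is \<open>0\<close>; if it is at a neighbour \<open>v\<close>, the mass is the sum
  of the mass at \<open>x\<close> and a share of the mass at \<open>v\<close> shortly before.  So the value at \<open>(x, t)\<close> is
  forced, and computable, as soon as this backward exploration ends after finitely many steps.

  If it does not end, then, since every vertex is hit only finitely often up to time \<open>t\<close>, the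
  exploration contains an infinite sequence of moves from a vertex to a neighbour that has just been
  hit, at decreasing times.  These times converge, so from some move on the hits lie in one slice
  \<open>k * \<delta> < s \<le> (k + 1) * \<delta>\<close>.  No vertex is visited infinitely often, so erasing loops leaves an infinite
  self-avoiding path of vertices that are all hit within the same slice.  By independence, a given
  self-avoiding path of \<open>m\<close> vertices has this property with probability at most \<open>\<delta> ^ m\<close>, and there
  are at most \<open>D ^ (m - 1)\<close> such paths from a given vertex if \<open>D\<close> bounds the degrees; for
  \<open>\<delta> = 1 / (2 * D)\<close> the expected number of paths tends to \<open>0\<close>, and infinite paths almost surely do not
  exist.  A connected locally finite graph is countable, so this holds for all starting vertices and
  all slices at once.  This is the argument by which Harris constructed interacting particle systems.

  Termination of the exploration is packaged as an induction principle (\<open>backward_induction\<close>) for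
  statements about pairs \<open>(x, t)\<close>.  Uniqueness follows by applying it to the statement that two
  solutions agree at \<open>(x, t)\<close>.  For existence, the process must also be measurable, and for this
  reason it is not defined by recursion along the exploration but as the limit of discrete-time
  schemes, in which a vertex counts as hit at a grid point if its Poisson process has increased since
  the previous grid point.  The schemes are measurable by induction on the number of steps.  At each
  of the three kinds of exploration step, a sufficiently fine scheme obeys the same rule as the
  meteor dynamics, so the induction principle shows convergence at every \<open>(x, t)\<close>, and the limit
  inherits the rules.
\<close>

section \<open>Jumps of counting paths\<close>

definition counting_path :: "(real \<Rightarrow> nat) \<Rightarrow> bool" where
  "counting_path f \<longleftrightarrow> mono_on {0..} f \<and> (\<forall>t\<ge>0. continuous (at_right t) f)"

lemma counting_path_mono: "counting_path f \<Longrightarrow> 0 \<le> s \<Longrightarrow> s \<le> t \<Longrightarrow> f s \<le> f t"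
  by (auto simp: counting_path_def intro: mono_onD[of "{0..}" f])

text \<open>
  If \<open>f\<close> has no jump in \<open>(s, t]\<close>, it is continuous on \<open>[s, t]\<close>, and an integer-valued continuous
  function on an interval cannot change.  Conversely, a monotone function with \<open>f s = f t\<close> is constant
  on \<open>[s, t]\<close>, hence left continuous there.  This lets the discrete scheme and the probability
  estimates detect jumps through increments over intervals.
\<close>

lemma counting_path_changes_iff_jump:
  assumes f: "counting_path f" and s: "0 \<le> s" "s \<le> t"
  shows "f t \<noteq> f s \<longleftrightarrow> jump_times f \<inter> {s<..t} \<noteq> {}"
proof
  assume ne: "f t \<noteq> f s"
  then have st: "s < t" using s by (cases "s = t") auto
  have le: "f s \<le> f t" using f s by (rule counting_path_mono)
  show "jump_times f \<inter> {s<..t} \<noteq> {}"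
  proof
    assume J: "jump_times f \<inter> {s<..t} = {}"
    have r: "(f \<longlongrightarrow> f u) (at_right u)" if "s \<le> u" for u
      using f that s by (auto simp: counting_path_def continuous_within)
    have l: "(f \<longlongrightarrow> f u) (at_left u)" if "s < u" "u \<le> t" for u
    proof -
      have "u \<notin> jump_times f" using J that by auto
      then show ?thesis using that s by (simp add: jump_times_def continuous_within)
    qed
    have c: "continuous_on {s..t} f"
      using r l st by (intro continuous_on_IccI) (auto simp: filterlim_split_at)
    have "continuous_on {s..t} (\<lambda>u. real (f u))"
      by (intro continuous_intros c)
    moreover have "real (f s) \<le> real (f s) + 1/2" "real (f s) + 1/2 \<le> real (f t)"
      using ne le by auto
    ultimately obtain u where "real (f u) = real (f s) + 1/2"
      using IVT'[of "\<lambda>u. real (f u)" s "real (f s) + 1/2" t] s by auto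
    then have "real (2 * f u) = real (2 * f s + 1)" by simp
    then have "2 * f u = 2 * f s + 1" by (simp only: of_nat_eq_iff)
    then show False by presburger
  qed
next
  assume "jump_times f \<inter> {s<..t} \<noteq> {}"
  then obtain u where u: "u \<in> jump_times f" "s < u" "u \<le> t" by auto
  show "f t \<noteq> f s"
  proof
    assume eq: "f t = f s"
    have m: "f a \<le> f b" if "s \<le> a" "a \<le> b" for a b
      using f s that by (auto intro: counting_path_mono)
    have "f x = f u" if "s < x" "x < u" for x
      using m[of s x] m[of x t] m[of s u] m[of u t] that u eq by auto
    then have "(f \<longlongrightarrow> f u) (at_left u)"
      using u by (intro tendsto_eventually) (auto simp: eventually_at_left[of s])
    then show False using u by (simp add: jump_times_def continuous_within)
  qed
qed

lemma finite_jump_times: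
  assumes f: "counting_path f"
  shows "finite (jump_times f \<inter> {..T})"
proof (rule finite_imageD)
  have lt: "f s < f t" if "s < t" "0 \<le> s" "t \<in> jump_times f" for s t
  proof -
    have "f s \<noteq> f t" using counting_path_changes_iff_jump[OF f, of s t] that by force
    moreover have "f s \<le> f t" using f that by (auto intro: counting_path_mono)
    ultimately show ?thesis by simp
  qed
  show "inj_on f (jump_times f \<inter> {..T})"
  proof (rule linorder_inj_onI)
    fix s t assume "s < t" "s \<in> jump_times f \<inter> {..T}" "t \<in> jump_times f \<inter> {..T}"
    then show "f s \<noteq> f t" using lt[of s t] by (auto simp: jump_times_def)
  qed auto
  have "f ` (jump_times f \<inter> {..T}) \<subseteq> {..f T}"
    using f by (auto simp: jump_times_def intro: counting_path_mono)
  then show "finite (f ` (jump_times f \<inter> {..T}))" by (rule finite_subset) simp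
qed

lemma finite_set_gap_right:
  fixes R :: "real set"
  assumes "finite (R \<inter> {..t + 1})"
  obtains e where "0 < e" "R \<inter> {t<..<t + e} = {}"
proof -
  define F where "F = insert (t + 1) (R \<inter> {..t + 1} \<inter> {t<..})"
  have F: "finite F" "F \<noteq> {}" using assms by (auto simp: F_def)
  have "Min F \<in> F" using F by (rule Min_in)
  then have "Min F > t" by (auto simp: F_def)
  moreover have "u \<notin> R" if "t < u" "u < Min F" for u
  proof
    assume "u \<in> R"
    moreover have "u \<le> t + 1" using that F Min_le[of F "t+1"] by (auto simp: F_def)
    ultimately have "u \<in> F" using that by (auto simp: F_def)
    then show False using Min_le[of F u] F that by auto
  qed
  ultimately show ?thesis by (intro that[of "Min F - t"]) auto
qed

lemma finite_set_gap_left: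
  fixes R :: "real set"
  assumes "finite (R \<inter> {..t})" "0 < t"
  obtains s where "0 \<le> s" "s < t" "R \<inter> {s<..<t} = {}"
proof -
  define F where "F = insert 0 (R \<inter> {..t} \<inter> {0<..<t})"
  have F: "finite F" "F \<noteq> {}" using assms by (auto simp: F_def)
  have "Max F \<in> F" using F by (rule Max_in)
  then have "Max F < t" using assms by (auto simp: F_def)
  moreover have "0 \<le> Max F" using F by (auto simp: F_def)
  moreover have "u \<notin> R" if "u < t" "Max F < u" for u
  proof
    assume "u \<in> R"
    then have "u \<in> F" using that \<open>0 \<le> Max F\<close> by (auto simp: F_def)
    then show False using Max_ge[of F u] F that by auto
  qed
  ultimately show ?thesis by (intro that[of "Max F"]) auto
qed

lemma left_lim_eq:
  assumes "s < t" "\<And>u. s < u \<Longrightarrow> u < t \<Longrightarrow> m u = c"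
  shows "left_lim m t = c"
  unfolding left_lim_def
  using assms by (intro tendsto_Lim tendsto_eventually) (auto simp: eventually_at_left[of s])

section \<open>Pathwise analysis of the dynamics\<close>

text \<open>
  From each vertex \<open>a\<close>, jump to the last visit \<open>L a\<close> of \<open>y\<close> to it and take the step that \<open>y\<close> takes then;
  no vertex occurs again after its last visit.
\<close>

lemma loop_erasure:
  fixes y :: "nat \<Rightarrow> 'a"
  assumes fin: "\<And>a. finite {i. y i = a}" and edge: "\<And>i. (y i, y (Suc i)) \<in> E"
  obtains z where "inj z" "\<And>i. (z i, z (Suc i)) \<in> E" "range z \<subseteq> range y"
proof -
  define L where "L a = Max {i. y i = a}" for a
  have L_ge: "j \<le> L (y j)" for j unfolding L_def using fin by (intro Max_ge) auto
  have yL: "y (L (y j)) = y j" for j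
    using Max_in[OF fin[of "y j"]] by (auto simp: L_def)
  define g where "g = rec_nat (L (y 0)) (\<lambda>_ k. L (y (Suc k)))"
  have gS: "g (Suc i) = L (y (Suc (g i)))" for i by (simp add: g_def)
  have gL: "g i = L (y (g i))" for i
    by (cases i) (simp_all add: gS yL, simp add: g_def yL)
  have "strict_mono g"
    using L_ge[of "Suc (g i)" for i] by (auto simp: strict_mono_Suc_iff gS Suc_le_eq)
  then have "inj g" by (rule strict_mono_imp_inj_on)
  then have "inj (y \<circ> g)" 
    by (intro injI) (metis comp_apply gL injD)
  moreover have "((y \<circ> g) i, (y \<circ> g) (Suc i)) \<in> E" for i
    using edge[of "g i"] by (simp add: gS yL)
  ultimately show ?thesis by (rule that) auto
qed

text \<open>
  The meteor dynamics sampled at the times \<open>h * j\<close>.  If several neighbours are hit in the same cell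
  of the grid, the rule ignores their order; this does no harm because any finite set of
  hits at distinct times is separated by a fine grid.
\<close>

primrec discrete_meteor ::
    "'v rel \<Rightarrow> ('v \<Rightarrow> real \<Rightarrow> nat) \<Rightarrow> ('v \<Rightarrow> real) \<Rightarrow> real \<Rightarrow> nat \<Rightarrow> 'v \<Rightarrow> real" where
  "discrete_meteor E n m0 h 0 = m0"
| "discrete_meteor E n m0 h (Suc j) = (\<lambda>x.
     if n x (h * real (Suc j)) \<noteq> n x (h * real j) then 0
     else discrete_meteor E n m0 h j x +
       (\<Sum>v\<in>E `` {x}. if n v (h * real (Suc j)) \<noteq> n v (h * real j)
          then discrete_meteor E n m0 h j v / real (card (E `` {v})) else 0))"

text \<open>
  Rounding up makes the scheme at the grid point of \<open>t\<close> include a hit at time \<open>t\<close> exactly.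
\<close>

definition grid :: "real \<Rightarrow> real \<Rightarrow> nat" where
  "grid h t = nat \<lceil>t / h\<rceil>"

lemma grid_bounds:
  assumes "0 < h" "0 \<le> t"
  shows "t \<le> h * real (grid h t)" "h * real (grid h t) < t + h"
proof -
  have "t / h \<le> real (grid h t)" "real (grid h t) < t / h + 1"
    using assms ceiling_correct[of "t / h"]
    by (auto simp: grid_def)
  then show "t \<le> h * real (grid h t)" "h * real (grid h t) < t + h"
    using assms by (simp_all add: field_simps)
qed

lemma grid_cell:
  assumes "0 < h" "0 < t"
  obtains j where "grid h t = Suc j" "h * real j < t" "t \<le> h * real (Suc j)"
proof -
  have "grid h t \<noteq> 0" using grid_bounds[of h t] assms by (intro notI) auto
  then obtain j where j: "grid h t = Suc j" using not0_implies_Suc by blast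
  then show ?thesis using that[OF j] grid_bounds[of h t] assms by (simp add: algebra_simps)
qed

definition meteor_mesh ::
    "'v rel \<Rightarrow> ('v \<Rightarrow> real \<Rightarrow> nat) \<Rightarrow> ('v \<Rightarrow> real) \<Rightarrow> nat \<Rightarrow> 'v \<Rightarrow> real \<Rightarrow> real" where
  "meteor_mesh E n m0 i v t =
     discrete_meteor E n m0 (1 / real (Suc i)) (grid (1 / real (Suc i)) t) v"

definition meteor_mass ::
    "'v rel \<Rightarrow> ('v \<Rightarrow> real \<Rightarrow> nat) \<Rightarrow> ('v \<Rightarrow> real) \<Rightarrow> 'v \<Rightarrow> real \<Rightarrow> real" where
  "meteor_mass E n m0 v t = lim (\<lambda>i. meteor_mesh E n m0 i v t)"

text \<open>
  The properties of a realization of the driving processes on which the pathwise argument rests.  The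
  last one says that the hits within one time slice do not percolate.
\<close>

locale meteor_driver =
  fixes V :: "'v set" and E :: "'v rel" and n :: "'v \<Rightarrow> real \<Rightarrow> nat"
  assumes E_sub: "E \<subseteq> V \<times> V" and E_sym: "sym E" and E_irrefl: "irrefl E"
    and fin_nbrs: "v \<in> V \<Longrightarrow> finite (E `` {v})"
    and counting: "v \<in> V \<Longrightarrow> counting_path (n v)"
    and no_common_jump: "u \<in> V \<Longrightarrow> v \<in> V \<Longrightarrow> u \<noteq> v \<Longrightarrow> jump_times (n u) \<inter> jump_times (n v) = {}"
    and no_infinite_chain: "\<exists>\<delta>>0. \<forall>k::nat. \<not> (\<exists>z. inj z \<and> (\<forall>i. (z i, z (Suc i)) \<in> E) \<and>
          (\<forall>i. jump_times (n (z i)) \<inter> {real k * \<delta><..real (Suc k) * \<delta>} \<noteq> {}))"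
begin

definition change_times :: "'v \<Rightarrow> real set" where
  "change_times x = (\<Union>v\<in>insert x (E `` {x}). jump_times (n v))"

lemma finite_change_times: "x \<in> V \<Longrightarrow> finite (change_times x \<inter> {..t})"
  unfolding change_times_def UN_extend_simps(4)
  using E_sub fin_nbrs counting by (intro finite_UN_I) (auto intro: finite_jump_times)

lemma change_times_pos: "t \<in> change_times x \<Longrightarrow> 0 < t"
  by (auto simp: change_times_def jump_times_def)

lemma gap_before:
  assumes "x \<in> V" "v \<in> V" "0 < t"
  obtains s where "0 \<le> s" "s < t" "(change_times x \<union> change_times v) \<inter> {s<..<t} = {}"
  using assms finite_change_times finite_set_gap_left[of "change_times x \<union> change_times v" t]
  by (auto simp: Int_Un_distrib2)

text \<open>
  The steps of the backward exploration that stay at \<open>x\<close> are harmless: each of them uses up one of the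
  finitely many change times of \<open>x\<close> below \<open>t\<close>.  So a failure of \<open>Q\<close> at \<open>(x, t)\<close> can be traced to a
  neighbour \<open>v\<close> and an earlier time \<open>s\<close> such that \<open>v\<close> is hit between \<open>s\<close> and \<open>t\<close>.
\<close>

lemma holds_if_holds_at_earlier_neighbours:
  assumes const: "\<And>x s t. x \<in> V \<Longrightarrow> 0 \<le> s \<Longrightarrow> s \<le> t \<Longrightarrow> change_times x \<inter> {s<..t} = {} \<Longrightarrow> Q x s \<Longrightarrow> Q x t"
    and init: "\<And>x. x \<in> V \<Longrightarrow> Q x 0"
    and self: "\<And>x t. x \<in> V \<Longrightarrow> t \<in> jump_times (n x) \<Longrightarrow> Q x t"
    and nbr: "\<And>x v s t. (x, v) \<in> E \<Longrightarrow> t \<in> jump_times (n v) \<Longrightarrow> 0 \<le> s \<Longrightarrow> s < t \<Longrightarrow>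
       (change_times x \<union> change_times v) \<inter> {s<..<t} = {} \<Longrightarrow> Q x s \<Longrightarrow> Q v s \<Longrightarrow> Q x t"
    and x: "x \<in> V" and t: "0 \<le> t"
    and hyp: "\<And>v s. (x, v) \<in> E \<Longrightarrow> 0 \<le> s \<Longrightarrow> s < t \<Longrightarrow> jump_times (n v) \<inter> {s<..t} \<noteq> {} \<Longrightarrow> Q v s"
  shows "Q x t"
  using t hyp
proof (induction "card (change_times x \<inter> {..t})" arbitrary: t rule: less_induct)
  case less
  let ?R = "change_times x \<inter> {..t}"
  have fin: "finite ?R" using x by (rule finite_change_times)
  show ?case
  proof (cases "?R = {}")
    case True
    then show ?thesis using less.prems(1) init[OF x] by (intro const[OF x, of 0 t]) auto
  next
    case False
    define t' where "t' = Max ?R"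
    have t': "t' \<in> ?R" using fin False unfolding t'_def by (rule Max_in)
    have last: "change_times x \<inter> {t'<..t} = {}"
      using Max_ge[OF fin] by (fastforce simp: t'_def)
    have pos: "0 < t'" using t' change_times_pos by auto
    have "Q x t'"
    proof (cases "t' \<in> jump_times (n x)")
      case True then show ?thesis by (rule self[OF x])
    next
      case False
      then obtain v where v: "(x, v) \<in> E" "t' \<in> jump_times (n v)"
        using t' by (auto simp: change_times_def)
      then have "v \<in> V" using E_sub by auto
      then obtain s where s: "0 \<le> s" "s < t'" "(change_times x \<union> change_times v) \<inter> {s<..<t'} = {}"
        using gap_before[OF x _ pos] by blast
      have "Q v s" using v s t' by (intro less.prems(2)) auto
      moreover have "Q x s"
      proof (rule less.hyps)
        show "card (change_times x \<inter> {..s}) < card ?R"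
        proof (rule psubset_card_mono[OF fin psubsetI])
          show "change_times x \<inter> {..s} \<noteq> ?R"
            using t' s by (metis Int_iff atMost_iff linorder_not_le)
        qed (use t' s in auto)
        show "Q u r" if "(x, u) \<in> E" "0 \<le> r" "r < s" "jump_times (n u) \<inter> {r<..s} \<noteq> {}" for u r
          using that s t' by (intro less.prems(2)) auto
      qed fact
      ultimately show ?thesis using nbr[OF v s] by blast
    qed
    then show ?thesis using last t' pos by (intro const[OF x, of t' t]) auto
  qed
qed


text \<open>
  A failure of \<open>Q\<close> propagates backwards through infinitely many neighbours \<open>y i\<close> at decreasing times
  \<open>\<tau> i\<close>, with a hit \<open>\<sigma> i\<close> of \<open>y (i + 1)\<close> in between.  The limit \<open>L\<close> of the times selects the slice that
  contains almost all of these hits, and loop erasure yields the forbidden infinite path.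
\<close>

lemma backward_induction:
  assumes const: "\<And>x s t. x \<in> V \<Longrightarrow> 0 \<le> s \<Longrightarrow> s \<le> t \<Longrightarrow> change_times x \<inter> {s<..t} = {} \<Longrightarrow> Q x s \<Longrightarrow> Q x t"
    and init: "\<And>x. x \<in> V \<Longrightarrow> Q x 0"
    and self: "\<And>x t. x \<in> V \<Longrightarrow> t \<in> jump_times (n x) \<Longrightarrow> Q x t"
    and nbr: "\<And>x v s t. (x, v) \<in> E \<Longrightarrow> t \<in> jump_times (n v) \<Longrightarrow> 0 \<le> s \<Longrightarrow> s < t \<Longrightarrow>
       (change_times x \<union> change_times v) \<inter> {s<..<t} = {} \<Longrightarrow> Q x s \<Longrightarrow> Q v s \<Longrightarrow> Q x t"
    and x: "x \<in> V" and t: "0 \<le> t"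
  shows "Q x t"
proof (rule ccontr)
  assume bad: "\<not> Q x t"
  define Bad where "Bad p \<longleftrightarrow> fst p \<in> V \<and> 0 \<le> snd p \<and> \<not> Q (fst p) (snd p)" for p
  define hop where "hop p q \<longleftrightarrow> (fst p, fst q) \<in> E \<and> snd q < snd p \<and>
     jump_times (n (fst q)) \<inter> {snd q<..snd p} \<noteq> {}" for p q
  have "\<exists>q. Bad q \<and> hop p q" if p: "Bad p" for p
  proof (rule ccontr)
    assume none: "\<nexists>q. Bad q \<and> hop p q"
    have "Q (fst p) (snd p)"
    proof (rule holds_if_holds_at_earlier_neighbours[where Q = Q])
      show "Q v s" if "(fst p, v) \<in> E" "0 \<le> s" "s < snd p"
        "jump_times (n v) \<inter> {s<..snd p} \<noteq> {}" for v s
      proof -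
        have "v \<in> V" using that E_sub by auto
        then show ?thesis
          using none[simplified not_ex, rule_format, of "(v, s)"] that by (auto simp: Bad_def hop_def)
      qed
    qed ((fact const init self nbr | use p in \<open>simp add: Bad_def\<close>)+)
    then show False using p by (simp add: Bad_def)
  qed
  moreover have "Bad (x, t)" using bad x t by (simp add: Bad_def)
  ultimately obtain p where p: "\<And>i. Bad (p i)" "\<And>i. hop (p i) (p (Suc i))"
    using dependent_nat_choice[of "\<lambda>_. Bad" "\<lambda>_. hop"] by metis
  define y where "y i = fst (p i)" for i
  define \<tau> where "\<tau> i = snd (p i)" for i
  have edge: "(y i, y (Suc i)) \<in> E" and dec: "\<tau> (Suc i) < \<tau> i" and pos: "0 \<le> \<tau> i"
    and jump: "\<exists>\<sigma>. \<sigma> \<in> jump_times (n (y (Suc i))) \<and> \<tau> (Suc i) < \<sigma> \<and> \<sigma> \<le> \<tau> i" for i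
    using p(1)[of i] p(2)[of i] by (auto simp: Bad_def hop_def y_def \<tau>_def)
  from jump obtain \<sigma> where \<sigma>: "\<And>i. \<sigma> i \<in> jump_times (n (y (Suc i)))"
    "\<And>i. \<tau> (Suc i) < \<sigma> i" "\<And>i. \<sigma> i \<le> \<tau> i" by metis
  have "decseq \<tau>" using dec by (intro decseq_SucI) (simp add: less_imp_le)
  then obtain L where L: "\<tau> \<longlonglongrightarrow> L" "\<And>i. L \<le> \<tau> i"
    using decseq_convergent[of \<tau> 0] pos by auto
  have "0 \<le> L" using L(1) pos by (intro LIMSEQ_le_const) auto
  obtain \<delta> where \<delta>: "0 < \<delta>" and no_chain: "\<And>k z. inj z \<Longrightarrow> (\<And>i. (z i, z (Suc i)) \<in> E) \<Longrightarrow>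
      (\<And>i. jump_times (n (z i)) \<inter> {real k * \<delta><..real (Suc k) * \<delta>} \<noteq> {}) \<Longrightarrow> False"
    using no_infinite_chain by metis
  \<comment> \<open>The times decrease to \<open>L\<close>, so the slice must contain a right neighbourhood of \<open>L\<close>.\<close>
  define k where "k = nat \<lfloor>L / \<delta>\<rfloor>"
  have "real k = of_int \<lfloor>L / \<delta>\<rfloor>" using \<open>0 \<le> L\<close> \<delta> by (simp add: k_def)
  then have "real k \<le> L / \<delta>" "L / \<delta> < real (Suc k)" by linarith+
  then have k: "real k * \<delta> \<le> L" "L < real (Suc k) * \<delta>"
    using \<delta> by (simp_all add: field_simps)
  then obtain i0 where i0: "\<And>i. i \<ge> i0 \<Longrightarrow> \<tau> i < real (Suc k) * \<delta>"
    using order_tendstoD(2)[OF L(1), of "real (Suc k) * \<delta>"] by (auto simp: eventually_sequentially)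
  \<comment> \<open>Distinct visits to a vertex come with distinct hits of it, all before time \<open>\<tau> 0\<close>.\<close>
  have "inj \<sigma>"
  proof (rule linorder_injI)
    fix i j :: nat assume "i < j"
    then have "\<tau> j \<le> \<tau> (Suc i)" using \<open>decseq \<tau>\<close> by (auto simp: decseq_def)
    then have "\<sigma> j < \<sigma> i" using \<sigma>(2)[of i] \<sigma>(3)[of j] by simp
    then show "\<sigma> i \<noteq> \<sigma> j" by simp
  qed
  have fin: "finite {i. y (Suc (i + i0)) = a}" for a
  proof (cases "a \<in> V")
    case True
    show ?thesis
    proof (rule finite_imageD)
      have "\<sigma> i \<le> \<tau> 0" for i using \<sigma>(3)[of i] \<open>decseq \<tau>\<close> by (auto simp: decseq_def intro: order_trans)
      then show "finite ((\<lambda>i. \<sigma> (i + i0)) ` {i. y (Suc (i + i0)) = a})"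
        using \<sigma>(1) by (intro finite_subset[OF _ finite_jump_times[OF counting[OF True], of "\<tau> 0"]]) auto
      show "inj_on (\<lambda>i. \<sigma> (i + i0)) {i. y (Suc (i + i0)) = a}"
        using inj_eq[OF \<open>inj \<sigma>\<close>] by (auto simp: inj_on_def)
    qed
  next
    case False
    then have "{i. y (Suc (i + i0)) = a} = {}" using p(1) by (auto simp: y_def Bad_def)
    then show ?thesis by simp
  qed
  obtain z where z: "inj z" "\<And>i. (z i, z (Suc i)) \<in> E" "range z \<subseteq> range (\<lambda>i. y (Suc (i + i0)))"
    by (rule loop_erasure[of "\<lambda>i. y (Suc (i + i0))" E]) (use fin edge in auto)
  show False
  proof (rule no_chain[OF z(1,2)])
    fix i
    obtain j where j: "z i = y (Suc (j + i0))" using z(3) by blast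
    have "real k * \<delta> < \<sigma> (j + i0)" using k(1) L(2)[of "Suc (j + i0)"] \<sigma>(2)[of "j + i0"] by linarith
    moreover have "\<sigma> (j + i0) \<le> real (Suc k) * \<delta>" using i0[of "j + i0"] \<sigma>(3)[of "j + i0"] by simp
    ultimately show "jump_times (n (z i)) \<inter> {real k * \<delta><..real (Suc k) * \<delta>} \<noteq> {}"
      using \<sigma>(1)[of "j + i0"] by (auto simp: j)
  qed
qed

lemma changes_iff:
  assumes "v \<in> V" "0 \<le> h"
  shows "n v (h * real (Suc j)) \<noteq> n v (h * real j) \<longleftrightarrow>
    jump_times (n v) \<inter> {h * real j<..h * real (Suc j)} \<noteq> {}"
  using assms by (intro counting_path_changes_iff_jump counting) (auto simp: mult_left_mono)

lemma discrete_const_nat: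
  assumes x: "x \<in> V" and h: "0 \<le> h" and "a \<le> b"
    and "change_times x \<inter> {h * real a<..h * real b} = {}"
  shows "discrete_meteor E n m0 h b x = discrete_meteor E n m0 h a x"
  using assms(3,4)
proof (induction b rule: dec_induct)
  case (step j)
  have le: "h * real a \<le> h * real j" "h * real j \<le> h * real (Suc j)"
    using step.hyps h by (auto intro: mult_left_mono)
  have none: "\<not> n v (h * real (Suc j)) \<noteq> n v (h * real j)" if "v \<in> insert x (E `` {x})" for v
  proof -
    have "v \<in> V" using that x E_sub by auto
    moreover have "jump_times (n v) \<subseteq> change_times x" using that by (auto simp: change_times_def)
    ultimately show ?thesis
      unfolding changes_iff[OF \<open>v \<in> V\<close> h] using step.prems le by auto
  qed
  then have "discrete_meteor E n m0 h (Suc j) x = discrete_meteor E n m0 h j x" by simp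
  moreover have "change_times x \<inter> {h * real a<..h * real j} = {}" using step.prems le by auto
  ultimately show ?case using step.IH by simp
qed simp

lemma discrete_const:
  assumes x: "x \<in> V" and h: "0 < h" and s: "0 \<le> s" "s \<le> t"
    and R: "change_times x \<inter> {s<..<t + h} = {}"
  shows "discrete_meteor E n m0 h (grid h t) x = discrete_meteor E n m0 h (grid h s) x"
proof (rule discrete_const_nat[OF x])
  show "grid h s \<le> grid h t"
    unfolding grid_def using h s by (intro nat_mono ceiling_mono divide_right_mono) auto
  show "change_times x \<inter> {h * real (grid h s)<..h * real (grid h t)} = {}"
    using R grid_bounds[of h s] grid_bounds[of h t] h s by auto
qed (use h in simp)

lemma discrete_self:
  assumes x: "x \<in> V" and h: "0 < h" and t: "t \<in> jump_times (n x)"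
  shows "discrete_meteor E n m0 h (grid h t) x = 0"
proof -
  have "0 < t" using t by (simp add: jump_times_def)
  then obtain j where j: "grid h t = Suc j" "h * real j < t" "t \<le> h * real (Suc j)"
    using grid_cell[OF h] by blast
  have "n x (h * real (Suc j)) \<noteq> n x (h * real j)"
    using changes_iff[of x h j] x h t j by auto
  then show ?thesis by (simp add: j(1))
qed

text \<open>
  Once \<open>h\<close> is below the distance from \<open>t\<close> to the neighbouring change times, the grid cell of \<open>t\<close>
  contains only the hit at \<open>t\<close>, and no two vertices are hit simultaneously; so the cell transfers mass
  from \<open>v\<close> alone, and before that cell nothing has happened since \<open>s\<close>.
\<close>

lemma discrete_nbr:
  assumes xv: "(x, v) \<in> E" and h: "0 < h" and t: "t \<in> jump_times (n v)"
    and s: "0 \<le> s" "s \<le> t - h"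
    and gap: "(change_times x \<union> change_times v) \<inter> {s<..<t} = {}"
    and gap': "change_times x \<inter> {t<..<t + h} = {}"
  shows "discrete_meteor E n m0 h (grid h t) x = discrete_meteor E n m0 h (grid h s) x +
    discrete_meteor E n m0 h (grid h s) v / real (card (E `` {v}))"
proof -
  have V: "x \<in> V" "v \<in> V" using xv E_sub by auto
  have "0 < t" using t by (simp add: jump_times_def)
  then obtain j where j: "grid h t = Suc j" "h * real j < t" "t \<le> h * real (Suc j)"
    using grid_cell[OF h] by blast
  have "h * real (Suc j) < t + h" using grid_bounds(2)[of h t] h \<open>0 < t\<close> by (simp add: j(1))
  have s_lt: "s < h * real j + h" "s \<le> h * real j"
    using s j by (simp_all add: algebra_simps)
  have sj: "grid h s \<le> j"
    using s_lt h by (simp add: grid_def ceiling_le_iff field_simps nat_le_iff)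
  have pre: "discrete_meteor E n m0 h j u = discrete_meteor E n m0 h (grid h s) u"
    if "u = x \<or> u = v" for u
  proof (rule discrete_const_nat[OF _ _ sj])
    show "change_times u \<inter> {h * real (grid h s)<..h * real j} = {}"
      using that gap grid_bounds(1)[of h s] h s(1) j(2) by fastforce
  qed (use V that h in auto)
  have ch: "n u (h * real (Suc j)) \<noteq> n u (h * real j) \<longleftrightarrow> u = v" if u: "u \<in> insert x (E `` {x})" for u
  proof -
    have uV: "u \<in> V" using u V E_sub by auto
    have sub: "jump_times (n u) \<subseteq> change_times x" using u by (auto simp: change_times_def)
    have "jump_times (n u) \<inter> {h * real j<..h * real (Suc j)} \<subseteq> {t}"
    proof
      fix r assume r: "r \<in> jump_times (n u) \<inter> {h * real j<..h * real (Suc j)}"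
      then have "r \<in> change_times x" "s < r" "r < t + h"
        using sub s_lt \<open>h * real (Suc j) < t + h\<close> by auto
      then show "r \<in> {t}" using gap gap' by (cases r t rule: linorder_cases) auto
    qed
    moreover have "t \<in> jump_times (n u) \<longleftrightarrow> u = v"
      using t no_common_jump[OF uV V(2)] by auto
    ultimately show ?thesis
      unfolding changes_iff[OF uV less_imp_le[OF h]] using j by fastforce
  qed
  have "x \<noteq> v" using xv E_irrefl by (auto simp: irrefl_def)
  then have nx: "\<not> n x (h * real (Suc j)) \<noteq> n x (h * real j)" using ch[of x] by simp
  have "(\<Sum>u\<in>E `` {x}. if n u (h * real (Suc j)) \<noteq> n u (h * real j)
          then discrete_meteor E n m0 h j u / real (card (E `` {u})) else 0) =
        (\<Sum>u\<in>E `` {x}. if u = v then discrete_meteor E n m0 h j u / real (card (E `` {u})) else 0)"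
    using ch by (intro sum.cong) auto
  also have "\<dots> = discrete_meteor E n m0 h j v / real (card (E `` {v}))"
    using xv fin_nbrs[OF V(1)] by simp
  finally show ?thesis using nx pre by (simp add: j(1))
qed


lemma eventually_mesh:
  assumes "0 < e"
  shows "\<forall>\<^sub>F i in sequentially. 1 / real (Suc i) \<le> e"
  using order_tendstoD(2)[OF LIMSEQ_inverse_real_of_nat assms]
  by eventually_elim (simp add: inverse_eq_divide)

abbreviation "mesh_mass \<equiv> meteor_mesh E n"

text \<open>
  The grid point of \<open>t\<close> may lie after \<open>t\<close>, so the mesh must be finer than the gap between \<open>t\<close> and the
  next time at which the mass at \<open>x\<close> can change.
\<close>

lemma mesh_const:
  assumes x: "x \<in> V" and s: "0 \<le> s" "s \<le> t" and R: "change_times x \<inter> {s<..t} = {}"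
  shows "\<forall>\<^sub>F i in sequentially. mesh_mass m0 i x t = mesh_mass m0 i x s"
proof -
  obtain e where e: "0 < e" "change_times x \<inter> {t<..<t + e} = {}"
    using finite_set_gap_right finite_change_times[OF x] by metis
  from eventually_mesh[OF e(1)] show ?thesis
  proof eventually_elim
    case (elim i)
    have "change_times x \<inter> {s<..<t + 1 / real (Suc i)} = {}"
    proof (intro equalityI subsetI)
      fix u assume "u \<in> change_times x \<inter> {s<..<t + 1 / real (Suc i)}"
      then show "u \<in> {}" using R e(2) elim by (cases "u \<le> t") auto
    qed simp
    then show ?case unfolding meteor_mesh_def using x s by (intro discrete_const) auto
  qed
qed

lemma mesh_self: "x \<in> V \<Longrightarrow> t \<in> jump_times (n x) \<Longrightarrow> mesh_mass m0 i x t = 0"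
  unfolding meteor_mesh_def by (rule discrete_self) auto

lemma mesh_init: "mesh_mass m0 i x 0 = m0 x"
  by (simp add: meteor_mesh_def grid_def)

lemma mesh_nbr:
  assumes xv: "(x, v) \<in> E" and t: "t \<in> jump_times (n v)" and s: "0 \<le> s" "s < t"
    and gap: "(change_times x \<union> change_times v) \<inter> {s<..<t} = {}"
  shows "\<forall>\<^sub>F i in sequentially. mesh_mass m0 i x t =
    mesh_mass m0 i x s + mesh_mass m0 i v s / real (card (E `` {v}))"
proof -
  have x: "x \<in> V" using xv E_sub by auto
  obtain e where e: "0 < e" "change_times x \<inter> {t<..<t + e} = {}"
    using finite_set_gap_right finite_change_times[OF x] by metis
  have "0 < t - s" using s by simp
  from eventually_mesh[OF e(1)] eventually_mesh[OF this] show ?thesis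
  proof eventually_elim
    case (elim i)
    then show ?case unfolding meteor_mesh_def
      using xv t s gap e by (intro discrete_nbr) auto
  qed
qed

section \<open>Existence and uniqueness for a fixed realization\<close>

text \<open>
  The rules satisfied by fine schemes transport convergence along each exploration step.
\<close>

lemma mesh_convergent:
  assumes "x \<in> V" "0 \<le> t"
  shows "convergent (\<lambda>i. mesh_mass m0 i x t)"
proof (rule backward_induction[where Q = "\<lambda>x t. convergent (\<lambda>i. mesh_mass m0 i x t)"])
  show "convergent (\<lambda>i. mesh_mass m0 i x t)"
    if "x \<in> V" "0 \<le> s" "s \<le> t" "change_times x \<inter> {s<..t} = {}" "convergent (\<lambda>i. mesh_mass m0 i x s)"
    for x s t
    using that(5) convergent_cong[OF mesh_const[OF that(1-4)]] by blast
  show "convergent (\<lambda>i. mesh_mass m0 i x t)"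
    if *: "(x, v) \<in> E" "t \<in> jump_times (n v)" "0 \<le> s" "s < t"
      "(change_times x \<union> change_times v) \<inter> {s<..<t} = {}"
      and c: "convergent (\<lambda>i. mesh_mass m0 i x s)" "convergent (\<lambda>i. mesh_mass m0 i v s)"
    for x v s t
    unfolding convergent_cong[OF mesh_nbr[OF *]] divide_inverse
    using c by (intro convergent_add convergent_mult convergent_const)
qed (use assms in \<open>auto simp: mesh_self mesh_init convergent_const\<close>)

abbreviation "mass \<equiv> meteor_mass E n"

lemma mesh_tendsto: "x \<in> V \<Longrightarrow> 0 \<le> t \<Longrightarrow> (\<lambda>i. mesh_mass m0 i x t) \<longlonglongrightarrow> mass m0 x t"
  unfolding meteor_mass_def by (subst convergent_LIMSEQ_iff[symmetric]) (rule mesh_convergent)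

lemma mass_const:
  assumes "x \<in> V" "0 \<le> s" "s \<le> t" "change_times x \<inter> {s<..t} = {}"
  shows "mass m0 x t = mass m0 x s"
proof (rule LIMSEQ_unique)
  show "(\<lambda>i. mesh_mass m0 i x t) \<longlonglongrightarrow> mass m0 x t" using assms by (intro mesh_tendsto) auto
  show "(\<lambda>i. mesh_mass m0 i x t) \<longlonglongrightarrow> mass m0 x s"
    unfolding tendsto_cong[OF mesh_const[OF assms]] using assms by (intro mesh_tendsto) auto
qed

lemma mass_nbr:
  assumes "(x, v) \<in> E" "t \<in> jump_times (n v)" "0 \<le> s" "s < t"
    "(change_times x \<union> change_times v) \<inter> {s<..<t} = {}"
  shows "mass m0 x t = mass m0 x s + mass m0 v s / real (card (E `` {v}))"
proof (rule LIMSEQ_unique)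
  have V: "x \<in> V" "v \<in> V" using assms(1) E_sub by auto
  show "(\<lambda>i. mesh_mass m0 i x t) \<longlonglongrightarrow> mass m0 x t" using assms V by (intro mesh_tendsto) auto
  show "(\<lambda>i. mesh_mass m0 i x t) \<longlonglongrightarrow> mass m0 x s + mass m0 v s / real (card (E `` {v}))"
    unfolding tendsto_cong[OF mesh_nbr[OF assms]] divide_inverse
    using assms V by (intro tendsto_intros mesh_tendsto) auto
qed

lemma discrete_nonneg:
  assumes "\<And>v. v \<in> V \<Longrightarrow> 0 \<le> m0 v" "x \<in> V"
  shows "0 \<le> discrete_meteor E n m0 h j x"
  using assms(2)
proof (induction j arbitrary: x)
  case (Suc j)
  have "v \<in> V" if "v \<in> E `` {x}" for v using that E_sub by auto
  then show ?case using Suc by (auto intro!: add_nonneg_nonneg sum_nonneg divide_nonneg_nonneg)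
qed (use assms(1) in simp)

lemma meteor_path_mass:
  assumes m0: "\<And>v. v \<in> V \<Longrightarrow> 0 \<le> m0 v"
  shows "meteor_path V E n m0 (mass m0)"
  unfolding meteor_path_def
proof (intro conjI ballI allI impI)
  show "mass m0 v 0 = m0 v" for v by (simp add: meteor_mass_def mesh_init)
  show "0 \<le> mass m0 v t" if "v \<in> V" "0 \<le> t" for v t
    by (rule LIMSEQ_le_const[OF mesh_tendsto[OF that]])
       (use discrete_nonneg[OF m0 that(1)] in \<open>simp add: meteor_mesh_def\<close>)
  show "mass m0 v t = 0" if "v \<in> V" "t \<in> jump_times (n v)" for v t
    using that by (simp add: meteor_mass_def mesh_self)
  show "mass m0 x t = left_lim (mass m0 x) t + left_lim (mass m0 v) t / real (card (E `` {v}))"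
    if v: "v \<in> V" and t: "t \<in> jump_times (n v)" and x: "x \<in> E `` {v}" for v t x
  proof -
    have xv: "(x, v) \<in> E" "x \<in> V" using x E_sym E_sub by (auto dest: symD)
    obtain s where s: "0 \<le> s" "s < t" and gap: "(change_times x \<union> change_times v) \<inter> {s<..<t} = {}"
      using gap_before[OF xv(2) v] t by (auto simp: jump_times_def)
    have "left_lim (mass m0 u) t = mass m0 u s" if "u = x \<or> u = v" for u
      using s gap that xv v by (intro left_lim_eq[of s] mass_const) force+
    then show ?thesis using mass_nbr[OF xv(1) t s gap] by simp
  qed
  show "mass m0 x t = mass m0 x s" if "x \<in> V"
    "0 \<le> s \<and> s < t \<and> (\<forall>v\<in>insert x (E `` {x}). jump_times (n v) \<inter> {s<..t} = {})" for x s t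
    using that by (intro mass_const) (auto simp: change_times_def)
qed

lemma meteor_path_const:
  assumes "meteor_path V E n m0 m" "x \<in> V" "0 \<le> s" "s \<le> t" "change_times x \<inter> {s<..t} = {}"
  shows "m x t = m x s"
proof (cases "s = t")
  case False
  have "\<forall>v\<in>insert x (E `` {x}). jump_times (n v) \<inter> {s<..t} = {}"
    using assms(5) by (auto simp: change_times_def)
  then show ?thesis using assms(1-4) False unfolding meteor_path_def by auto
qed simp

text \<open>
  The transfer rule freed of left limits: both masses are constant on \<open>[s, t)\<close>, so their left limits
  at \<open>t\<close> are their values at \<open>s\<close>.
\<close>

lemma meteor_path_nbr:
  assumes m: "meteor_path V E n m0 m" and xv: "(x, v) \<in> E" and t: "t \<in> jump_times (n v)"
    and s: "0 \<le> s" "s < t" and gap: "(change_times x \<union> change_times v) \<inter> {s<..<t} = {}"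
  shows "m x t = m x s + m v s / real (card (E `` {v}))"
proof -
  have V: "x \<in> V" "v \<in> V" "x \<in> E `` {v}" using xv E_sub E_sym by (auto dest: symD)
  have "left_lim (m u) t = m u s" if "u = x \<or> u = v" for u
    using s gap that V by (intro left_lim_eq[of s] meteor_path_const[OF m]) force+
  moreover have "m x t = left_lim (m x) t + left_lim (m v) t / real (card (E `` {v}))"
    using m V t unfolding meteor_path_def by blast
  ultimately show ?thesis by simp
qed

lemma meteor_path_unique:
  assumes m: "meteor_path V E n m0 m" and m': "meteor_path V E n m0 m'" and x: "x \<in> V" "0 \<le> t"
  shows "m x t = m' x t"
proof (rule backward_induction[where Q = "\<lambda>x t. m x t = m' x t"])
  show "m x t = m' x t"
    if "x \<in> V" "0 \<le> s" "s \<le> t" "change_times x \<inter> {s<..t} = {}" "m x s = m' x s" for x s t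
    using meteor_path_const[OF m that(1-4)] meteor_path_const[OF m' that(1-4)] that(5) by simp
  show "m x 0 = m' x 0" if "x \<in> V" for x using m m' that by (simp add: meteor_path_def)
  show "m x t = m' x t" if "x \<in> V" "t \<in> jump_times (n x)" for x t
    using m m' that by (simp add: meteor_path_def)
  show "m x t = m' x t"
    if *: "(x, v) \<in> E" "t \<in> jump_times (n v)" "0 \<le> s" "s < t"
      "(change_times x \<union> change_times v) \<inter> {s<..<t} = {}" and "m x s = m' x s" "m v s = m' v s" for x v s t
    using meteor_path_nbr[OF m *] meteor_path_nbr[OF m' *] that(6,7) by simp
qed fact+

end

section \<open>Probability estimates for the driving processes\<close>

lemma measurable_nat_diff:
  fixes f g :: "'a \<Rightarrow> nat"
  assumes f: "f \<in> measurable M (count_space UNIV)" and g: "g \<in> measurable M (count_space UNIV)"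
  shows "(\<lambda>x. f x - g x) \<in> measurable M (count_space UNIV)"
  by (rule measurable_compose_countable[OF _ g, where f = "\<lambda>i x. f x - i"])
     (rule measurable_compose[OF f], simp)

context prob_space
begin

text \<open>
  An event about all infinite paths in a graph is a union over uncountably many of them; covering it
  by measurable events of small probability avoids the question of its measurability.
\<close>

lemma AE_not_if_small_covers:
  assumes small: "\<And>e. 0 < e \<Longrightarrow> \<exists>A\<in>events. prob A \<le> e \<and> {w \<in> space M. B w} \<subseteq> A"
  shows "AE w in M. \<not> B w"
proof -
  have "\<exists>A. \<forall>i. A i \<in> events \<and> prob (A i) \<le> 1 / real (Suc i) \<and> {w \<in> space M. B w} \<subseteq> A i"
    using small[of "1 / real (Suc i)" for i] by (intro choice) (simp, blast)
  then obtain A where A: "\<And>i. A i \<in> events" "\<And>i. prob (A i) \<le> 1 / real (Suc i)"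
    "\<And>i. {w \<in> space M. B w} \<subseteq> A i" by blast
  have Z: "(\<Inter>i. A i) \<in> events" using A(1) by auto
  have "prob (\<Inter>i. A i) \<le> 1 / real (Suc i)" for i
    using A(1) A(2)[of i] finite_measure_mono[of "\<Inter>i. A i" "A i"] by fastforce
  then have "prob (\<Inter>i. A i) \<le> 0"
    using LIMSEQ_inverse_real_of_nat by (intro LIMSEQ_le_const) (auto simp: inverse_eq_divide)
  then have "(\<Inter>i. A i) \<in> null_sets M"
    using Z by (auto simp: null_sets_def emeasure_eq_measure measure_le_0_iff)
  then show ?thesis by (rule AE_I') (use A(3) in auto)
qed

lemma increase_event:
  assumes "poisson_process M 1 Q" "0 \<le> s" "0 \<le> t"
  shows "{w \<in> space M. Q s w < Q t w} \<in> events"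
proof -
  have "(\<lambda>w. Q t w - Q s w) \<in> measurable M (count_space UNIV)"
    using assms by (intro measurable_nat_diff) (auto simp: poisson_process_def)
  then have "(\<lambda>w. Q t w - Q s w) -` {0<..} \<inter> space M \<in> events" by (rule measurable_sets) simp
  also have "(\<lambda>w. Q t w - Q s w) -` {0<..} \<inter> space M = {w \<in> space M. Q s w < Q t w}" by auto
  finally show ?thesis .
qed

lemma prob_increase:
  assumes Q: "poisson_process M 1 Q" and st: "0 \<le> s" "s < t"
  shows "prob {w \<in> space M. Q s w < Q t w} \<le> t - s"
proof -
  let ?D = "\<lambda>w. Q t w - Q s w"
  have D: "?D \<in> measurable M (count_space UNIV)"
    using assms by (intro measurable_nat_diff) (auto simp: poisson_process_def)
  have distr: "distr M (count_space UNIV) ?D = measure_pmf (poisson_pmf (t - s))"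
    using Q st by (simp add: poisson_process_def)
  have "prob {w \<in> space M. Q s w < Q t w} = prob (?D -` (UNIV - {0}) \<inter> space M)"
    by (rule arg_cong[of _ _ prob]) auto
  also have "\<dots> = measure (distr M (count_space UNIV) ?D) (UNIV - {0})"
    using D by (simp add: measure_distr)
  also have "\<dots> = 1 - pmf (poisson_pmf (t - s)) 0"
    unfolding distr using measure_pmf.prob_compl[of "{0}" "poisson_pmf (t - s)"]
    by (simp add: measure_pmf_single)
  also have "\<dots> = 1 - exp (- (t - s))" using st by simp
  also have "\<dots> \<le> t - s" using exp_ge_add_one_self[of "- (t - s)"] by linarith
  finally show ?thesis .
qed

text \<open>
  The single estimate behind both almost sure properties below: two vertices in a short interval for
  simultaneous hits, the vertices of a self-avoiding path in one slice for percolation.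
\<close>

lemma prob_all_increase:
  assumes pois: "\<And>v. v \<in> V \<Longrightarrow> poisson_process M 1 (N v)"
    and indep: "independent_processes M N V"
    and I: "finite I" "I \<subseteq> V" and st: "0 \<le> s" "s < t"
  shows "prob {w \<in> space M. \<forall>v\<in>I. N v s w < N v t w} \<le> (t - s) ^ card I"
proof (cases "I = {}")
  case True
  then show ?thesis by (simp add: prob_space)
next
  case False
  have Y: "(\<lambda>p::real \<Rightarrow> nat. p t - p s) \<in> measurable (PiM {0..} (\<lambda>_. count_space UNIV)) (count_space UNIV)"
    using st by (intro measurable_nat_diff measurable_component_singleton) auto
  have "indep_vars (\<lambda>_. count_space UNIV)
      (\<lambda>v w. (\<lambda>p. p t - p s) (restrict (\<lambda>t. N v t w) {0..})) V"
    by (rule indep_vars_compose2[OF indep[unfolded independent_processes_def]]) (rule Y)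
  then have ind: "indep_vars (\<lambda>_. count_space UNIV) (\<lambda>v w. N v t w - N v s w) V"
    using st by simp
  have eq: "(\<lambda>w. N v t w - N v s w) -` {0<..} \<inter> space M = {w \<in> space M. N v s w < N v t w}" for v
    by auto
  have "{w \<in> space M. \<forall>v\<in>I. N v s w < N v t w} = (\<Inter>v\<in>I. {w \<in> space M. N v s w < N v t w})"
    using False by auto
  also have "prob \<dots> = (\<Prod>v\<in>I. prob {w \<in> space M. N v s w < N v t w})"
    using indep_varsD[OF ind False I, of "\<lambda>_. {0<..}"] by (simp add: eq)
  also have "\<dots> \<le> (\<Prod>v\<in>I. t - s)"
    using I st pois by (intro prod_mono conjI prob_increase) auto
  finally show ?thesis by simp
qed

lemma all_increase_event:
  assumes pois: "\<And>v. v \<in> V \<Longrightarrow> poisson_process M 1 (N v)"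
    and I: "finite I" "I \<subseteq> V" and st: "0 \<le> s" "0 \<le> t"
  shows "{w \<in> space M. \<forall>v\<in>I. N v s w < N v t w} \<in> events"
  using I pois st by (intro sets.sets_Collect_finite_All increase_event) auto

text \<open>
  Among \<open>m\<close> cells of length \<open>T / m\<close>, the probability that some cell contains increments of both
  processes is at most \<open>m * (T / m)\<^sup>2\<close>, which tends to \<open>0\<close>.
\<close>

lemma AE_no_common_increase:
  fixes T :: nat
  assumes pois: "\<And>v. v \<in> V \<Longrightarrow> poisson_process M 1 (N v)"
    and indep: "independent_processes M N V"
    and uv: "u \<in> V" "v \<in> V" "u \<noteq> v" and T: "0 < T"
  shows "AE w in M. \<not> (\<forall>m::nat>0. \<exists>j<m. \<forall>x\<in>{u, v}.
    N x (real T / real m * real j) w < N x (real T / real m * real (Suc j)) w)"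
proof (rule AE_not_if_small_covers)
  fix e :: real assume "0 < e"
  obtain m :: nat where m: "real T ^ 2 / e < real m" using reals_Archimedean2 by blast
  moreover have "0 < real T ^ 2 / e" using \<open>0 < e\<close> T by simp
  ultimately have "0 < m" using of_nat_0_less_iff[where 'a = real] by linarith
  define h where "h = real T / real m"
  have h: "0 < h" using T \<open>0 < m\<close> by (simp add: h_def)
  define A where "A j = {w \<in> space M. \<forall>x\<in>{u, v}. N x (h * real j) w < N x (h * real (Suc j)) w}" for j
  have A: "A j \<in> events" for j
    unfolding A_def using pois uv h by (intro all_increase_event) auto
  have "prob (A j) \<le> (h * real (Suc j) - h * real j) ^ card {u, v}" for j
    unfolding A_def using pois uv h indep by (intro prob_all_increase) auto
  then have prob_A: "prob (A j) \<le> h ^ 2" for j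
    using uv by (simp add: algebra_simps power2_eq_square)
  have "prob (\<Union>j<m. A j) \<le> (\<Sum>j<m. prob (A j))"
    using A by (intro finite_measure_subadditive_finite) auto
  also have "\<dots> \<le> (\<Sum>j<m. h ^ 2)" using prob_A by (rule sum_mono)
  also have "\<dots> = real T ^ 2 / real m"
    using \<open>0 < m\<close> by (simp add: h_def power2_eq_square)
  also have "\<dots> \<le> e" using m \<open>0 < e\<close> \<open>0 < m\<close> by (simp add: field_simps)
  finally have "prob (\<Union>j<m. A j) \<le> e" .
  moreover have "(\<Union>j<m. A j) \<in> events" using A by auto
  ultimately show "\<exists>A\<in>events. prob A \<le> e \<and> {w \<in> space M. \<forall>m::nat>0. \<exists>j<m. \<forall>x\<in>{u, v}.
    N x (real T / real m * real j) w < N x (real T / real m * real (Suc j)) w} \<subseteq> A"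
    using \<open>0 < m\<close> by (intro bexI[of _ "\<Union>j<m. A j"]) (auto simp: A_def h_def)
qed

end

lemma counting_path_jump_imp_less:
  assumes "counting_path f" "0 \<le> s" "s \<le> t" "jump_times f \<inter> {s<..t} \<noteq> {}"
  shows "f s < f t"
  using assms counting_path_changes_iff_jump[OF assms(1-3)] counting_path_mono[OF assms(1-3)] by auto

lemma no_common_jump_if_separated:
  assumes f: "counting_path f" and g: "counting_path g"
    and sep: "\<And>T::nat. 0 < T \<Longrightarrow> \<exists>m::nat>0. \<forall>j<m.
      \<not> (f (real T / real m * real j) < f (real T / real m * real (Suc j)) \<and>
         g (real T / real m * real j) < g (real T / real m * real (Suc j)))"
  shows "jump_times f \<inter> jump_times g = {}"
proof (rule ccontr)
  assume "jump_times f \<inter> jump_times g \<noteq> {}"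
  then obtain t where t: "t \<in> jump_times f" "t \<in> jump_times g" by blast
  then have "0 < t" by (simp add: jump_times_def)
  obtain T :: nat where T: "t < real T" using reals_Archimedean2 by blast
  then have "0 < T" using \<open>0 < t\<close> of_nat_0_less_iff[where 'a = real] by linarith
  then obtain m :: nat where m: "0 < m" and
    no: "\<And>j. j < m \<Longrightarrow> \<not> (f (real T / real m * real j) < f (real T / real m * real (Suc j)) \<and>
         g (real T / real m * real j) < g (real T / real m * real (Suc j)))"
    using sep by blast
  define h where "h = real T / real m"
  have h: "0 < h" using \<open>0 < T\<close> m by (simp add: h_def)
  obtain j where j: "h * real j < t" "t \<le> h * real (Suc j)"
    using grid_cell[OF h \<open>0 < t\<close>] by blast
  have "h * real j < h * real m" using j T m by (simp add: h_def)
  then have "j < m" using h by simp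
  moreover have "c (h * real j) < c (h * real (Suc j))" if "counting_path c" "t \<in> jump_times c" for c
    using j h that by (intro counting_path_jump_imp_less) (auto intro: mult_left_mono)
  ultimately show False using no f g t unfolding h_def by blast
qed

section \<open>Absence of percolation\<close>

primrec walks :: "'v rel \<Rightarrow> nat \<Rightarrow> 'v \<Rightarrow> 'v list set" where
  "walks E 0 v = {[v]}"
| "walks E (Suc m) v = (\<Union>u\<in>E `` {v}. (#) v ` walks E m u)"

lemma walks_bounds:
  assumes E: "E \<subseteq> V \<times> V" and deg: "\<And>v. v \<in> V \<Longrightarrow> finite (E `` {v}) \<and> card (E `` {v}) \<le> D"
    and v: "v \<in> V"
  shows "finite (walks E m v) \<and> card (walks E m v) \<le> D ^ m"
  using v
proof (induction m arbitrary: v)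
  case (Suc m)
  have IH: "finite (walks E m u) \<and> card (walks E m u) \<le> D ^ m" if "u \<in> E `` {v}" for u
    using that E by (intro Suc.IH) auto
  have "card (walks E (Suc m) v) \<le> (\<Sum>u\<in>E `` {v}. card ((#) v ` walks E m u))"
    using deg[OF Suc.prems] by (simp add: card_UN_le)
  also have "\<dots> \<le> (\<Sum>u\<in>E `` {v}. D ^ m)"
    using IH by (intro sum_mono) (auto intro: order_trans[OF card_image_le])
  also have "\<dots> \<le> D * D ^ m" using deg[OF Suc.prems] by simp
  finally show ?case using IH deg[OF Suc.prems] by auto
qed simp

lemma walks_elem:
  assumes "E \<subseteq> V \<times> V" "v \<in> V" "xs \<in> walks E m v"
  shows "set xs \<subseteq> V \<and> length xs = Suc m"
  using assms(2,3)
proof (induction m arbitrary: v xs)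
  case (Suc m)
  then obtain u ys where "(v, u) \<in> E" "xs = v # ys" "ys \<in> walks E m u" by auto
  then show ?case using Suc.IH[of u ys] Suc.prems(1) assms(1) by auto
qed simp

lemma walk_of_path:
  assumes "\<And>i. (z i, z (Suc i)) \<in> E"
  shows "map z [0..<Suc m] \<in> walks E m (z 0)"
  using assms
proof (induction m arbitrary: z)
  case (Suc m)
  have "map z [0..<Suc (Suc m)] = z 0 # map (\<lambda>i. z (Suc i)) [0..<Suc m]"
    by (simp add: upt_conv_Cons map_Suc_upt[symmetric] del: upt_Suc)
  then show ?case using Suc.IH[of "\<lambda>i. z (Suc i)"] Suc.prems by (auto simp del: upt_Suc)
qed simp

text \<open>
  First moment bound: the initial segment of such a path is one of at most \<open>D ^ m\<close> walks, and a walk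
  without repetitions visits \<open>m + 1\<close> vertices with independent processes, so the expected number of
  segments all of whose vertices are hit is at most \<open>(D * (t - s)) ^ m\<close>.
\<close>

lemma (in prob_space) AE_no_increasing_path:
  fixes D k :: nat
  assumes pois: "\<And>v. v \<in> V \<Longrightarrow> poisson_process M 1 (N v)"
    and indep: "independent_processes M N V"
    and E: "E \<subseteq> V \<times> V" and deg: "\<And>v. v \<in> V \<Longrightarrow> finite (E `` {v}) \<and> card (E `` {v}) \<le> D"
    and v: "v \<in> V" and st: "0 \<le> s" "s < t" and small: "real D * (t - s) \<le> 1 / 2" "t - s \<le> 1"
  shows "AE w in M. \<not> (\<exists>z. inj z \<and> z 0 = v \<and> (\<forall>i. (z i, z (Suc i)) \<in> E) \<and>
    (\<forall>i::nat. N (z i) s w < N (z i) t w))"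
proof (rule AE_not_if_small_covers)
  fix e :: real assume "0 < e"
  then obtain m where m: "(1 / 2) ^ m < e" using real_arch_pow_inv[of e "1/2"] by auto
  define W where "W = {xs \<in> walks E m v. distinct xs}"
  define A where "A xs = {w \<in> space M. \<forall>x\<in>set xs. N x s w < N x t w}" for xs
  have fin: "finite W" and cardW: "card W \<le> D ^ m"
    using walks_bounds[OF E deg v, of m] card_mono[of "walks E m v" W] by (auto simp: W_def)
  have W: "set xs \<subseteq> V" "card (set xs) = Suc m" if "xs \<in> W" for xs
    using that walks_elem[OF E v, of xs m] by (auto simp: W_def distinct_card)
  have A: "A xs \<in> events" if "xs \<in> W" for xs
    unfolding A_def using pois st W[OF that] by (intro all_increase_event) auto
  have "prob (A xs) \<le> (t - s) ^ Suc m" if "xs \<in> W" for xs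
    using prob_all_increase[OF pois indep _ W(1)[OF that] st] W(2)[OF that] by (simp add: A_def)
  then have "(\<Sum>xs\<in>W. prob (A xs)) \<le> (\<Sum>xs\<in>W. (t - s) ^ Suc m)" by (rule sum_mono)
  also have "\<dots> \<le> real D ^ m * (t - s) ^ Suc m"
    using cardW st by (auto intro!: mult_right_mono simp flip: of_nat_power simp del: power_Suc)
  also have "\<dots> = (real D * (t - s)) ^ m * (t - s)" by (simp add: power_mult_distrib)
  also have "\<dots> \<le> (1 / 2) ^ m * 1" using small st by (intro mult_mono power_mono) auto
  finally have "prob (\<Union>xs\<in>W. A xs) \<le> e"
    using m finite_measure_subadditive_finite[OF fin, of A] A by fastforce
  moreover have "(\<Union>xs\<in>W. A xs) \<in> events" using A fin by auto
  moreover have "w \<in> (\<Union>xs\<in>W. A xs)" if "w \<in> space M" "inj z" "z 0 = v"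
    "\<And>i. (z i, z (Suc i)) \<in> E" "\<And>i::nat. N (z i) s w < N (z i) t w" for w z
  proof
    show "map z [0..<Suc m] \<in> W"
      using walk_of_path[of z E m] that inj_on_subset[OF that(2)]
      by (auto simp: W_def distinct_map simp del: upt_Suc)
    show "w \<in> A (map z [0..<Suc m])" using that by (auto simp: A_def)
  qed
  ultimately show "\<exists>A\<in>events. prob A \<le> e \<and> {w \<in> space M. \<exists>z. inj z \<and> z 0 = v \<and>
      (\<forall>i. (z i, z (Suc i)) \<in> E) \<and> (\<forall>i::nat. N (z i) s w < N (z i) t w)} \<subseteq> A"
    by (intro bexI[of _ "\<Union>xs\<in>W. A xs"]) auto
qed

section \<open>The driven process\<close>

lemma countable_connected_locally_finite:
  assumes E: "E \<subseteq> V \<times> V" and conn: "\<forall>u\<in>V. \<forall>v\<in>V. (u, v) \<in> E\<^sup>*"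
    and fin: "\<And>v. v \<in> V \<Longrightarrow> finite (E `` {v})"
  shows "countable V"
proof (cases "V = {}")
  case False
  then obtain a where a: "a \<in> V" by blast
  have "countable (E\<^sup>* `` {a})"
  proof (rule countable_rtrancl)
    fix Y :: "'a set" assume "countable Y"
    have "finite (E `` {y})" for y using fin[of y] E by (cases "y \<in> V") (auto intro: finite_subset[of _ "{}"])
    then show "countable (E `` Y)"
      using \<open>countable Y\<close> by (subst Image_eq_UN) (auto intro: countable_finite)
  qed simp
  then show ?thesis by (rule countable_subset[rotated]) (use conn a in auto)
qed simp

text \<open>
  Countability of \<open>V\<close> allows the almost sure properties to be required for all vertices, all pairs of
  vertices, all slices and all time horizons simultaneously.
\<close>

lemma (in prob_space) AE_meteor_driver:
  fixes N :: "'v \<Rightarrow> real \<Rightarrow> 'a \<Rightarrow> nat"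
  assumes E: "E \<subseteq> V \<times> V" "sym E" "irrefl E"
    and conn: "\<forall>u\<in>V. \<forall>v\<in>V. (u, v) \<in> E\<^sup>*"
    and fin: "\<And>v. v \<in> V \<Longrightarrow> finite (E `` {v})"
    and bdd: "bdd_above ((\<lambda>v. card (E `` {v})) ` V)"
    and pois: "\<And>v. v \<in> V \<Longrightarrow> poisson_process M 1 (N v)"
    and indep: "independent_processes M N V"
  shows "AE w in M. meteor_driver V E (\<lambda>v t. N v t w)"
proof -
  have V: "countable V" using E conn fin by (intro countable_connected_locally_finite)
  from bdd obtain D0 where D0: "\<And>v. v \<in> V \<Longrightarrow> card (E `` {v}) \<le> D0" by (auto simp: bdd_above_def)
  define D where "D = Suc D0"
  have deg: "finite (E `` {v}) \<and> card (E `` {v}) \<le> D" if "v \<in> V" for v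
    using fin[OF that] D0[OF that] by (simp add: D_def)
  \<comment> \<open>Short enough for the first moment bound to decay geometrically.\<close>
  define \<delta> where "\<delta> = 1 / (2 * real D)"
  have \<delta>: "0 < \<delta>" "real D * \<delta> \<le> 1 / 2" "\<delta> \<le> 1" by (simp_all add: \<delta>_def D_def)
  have "AE w in M. \<forall>v\<in>V. counting_path (\<lambda>t. N v t w)"
    unfolding AE_ball_countable[OF V]
  proof
    fix v assume "v \<in> V"
    then have "AE w in M. N v 0 w = 0 \<and> mono_on {0..} (\<lambda>t. N v t w) \<and>
        (\<forall>t\<ge>0. continuous (at_right t) (\<lambda>s. N v s w))"
      using pois unfolding poisson_process_def by blast
    then show "AE w in M. counting_path (\<lambda>t. N v t w)"
      by eventually_elim (simp add: counting_path_def)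
  qed
  moreover have "AE w in M. \<forall>u\<in>V. \<forall>v\<in>V. \<forall>T::nat. u \<noteq> v \<and> 0 < T \<longrightarrow> \<not> (\<forall>m::nat>0. \<exists>j<m. \<forall>x\<in>{u, v}.
    N x (real T / real m * real j) w < N x (real T / real m * real (Suc j)) w)"
    unfolding AE_ball_countable[OF V] AE_all_countable
  proof (intro ballI allI)
    fix u v and T :: nat assume "u \<in> V" "v \<in> V"
    then show "AE w in M. u \<noteq> v \<and> 0 < T \<longrightarrow> \<not> (\<forall>m::nat>0. \<exists>j<m. \<forall>x\<in>{u, v}.
      N x (real T / real m * real j) w < N x (real T / real m * real (Suc j)) w)"
      using AE_no_common_increase[OF pois indep, of u v T] by (cases "u \<noteq> v \<and> 0 < T") auto
  qed
  moreover have "AE w in M. \<forall>v\<in>V. \<forall>k::nat. \<not> (\<exists>z. inj z \<and> z 0 = v \<and> (\<forall>i. (z i, z (Suc i)) \<in> E) \<and>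
    (\<forall>i::nat. N (z i) (real k * \<delta>) w < N (z i) (real (Suc k) * \<delta>) w))"
    unfolding AE_ball_countable[OF V] AE_all_countable
    using \<delta> by (intro ballI allI AE_no_increasing_path[OF pois indep E(1) deg]) (auto simp: algebra_simps)
  ultimately show ?thesis
  proof eventually_elim
    case (elim w)
    show ?case
    proof
      show "jump_times (\<lambda>t. N u t w) \<inter> jump_times (\<lambda>t. N v t w) = {}"
        if uv: "u \<in> V" "v \<in> V" "u \<noteq> v" for u v
      proof (rule no_common_jump_if_separated)
        fix T :: nat assume "0 < T"
        then have "\<not> (\<forall>m::nat>0. \<exists>j<m. \<forall>x\<in>{u, v}.
          N x (real T / real m * real j) w < N x (real T / real m * real (Suc j)) w)"
          using elim(2) uv by blast
        then show "\<exists>m::nat>0. \<forall>j<m.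
          \<not> (N u (real T / real m * real j) w < N u (real T / real m * real (Suc j)) w \<and>
             N v (real T / real m * real j) w < N v (real T / real m * real (Suc j)) w)"
          by simp blast
      qed (use elim(1) uv in auto)
      show "\<exists>\<delta>>0. \<forall>k::nat. \<not> (\<exists>z. inj z \<and> (\<forall>i. (z i, z (Suc i)) \<in> E) \<and>
          (\<forall>i. jump_times (\<lambda>t. N (z i) t w) \<inter> {real k * \<delta><..real (Suc k) * \<delta>} \<noteq> {}))"
      proof (intro exI[of _ \<delta>] conjI allI notI)
        fix k assume "\<exists>z. inj z \<and> (\<forall>i. (z i, z (Suc i)) \<in> E) \<and>
          (\<forall>i. jump_times (\<lambda>t. N (z i) t w) \<inter> {real k * \<delta><..real (Suc k) * \<delta>} \<noteq> {})"
        then obtain z where z: "inj z" "\<And>i. (z i, z (Suc i)) \<in> E"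
          "\<And>i. jump_times (\<lambda>t. N (z i) t w) \<inter> {real k * \<delta><..real (Suc k) * \<delta>} \<noteq> {}" by blast
        have zV: "z i \<in> V" for i using z(2)[of i] E(1) by auto
        have "N (z i) (real k * \<delta>) w < N (z i) (real (Suc k) * \<delta>) w" for i
          using z(3)[of i] elim(1) zV \<delta>(1) by (intro counting_path_jump_imp_less) (auto simp: mult_right_mono)
        then show False using elim(3) zV[of 0] z(1,2) by blast
      qed (rule \<delta>)
    qed (use E fin elim(1) in auto)
  qed
qed

lemma measurable_discrete_meteor:
  assumes E: "E \<subseteq> V \<times> V" and N: "\<And>v t. v \<in> V \<Longrightarrow> 0 \<le> t \<Longrightarrow> N v t \<in> measurable P (count_space UNIV)"
    and M0: "\<And>v. v \<in> V \<Longrightarrow> M0 v \<in> borel_measurable P" and h: "0 \<le> h" and x: "x \<in> V"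
  shows "(\<lambda>w. discrete_meteor E (\<lambda>v t. N v t w) (\<lambda>v. M0 v w) h j x) \<in> borel_measurable P"
  using x
proof (induction j arbitrary: x)
  case (Suc j)
  have pr: "Measurable.pred P (\<lambda>w. N v (h * real (Suc j)) w \<noteq> N v (h * real j) w)" if "v \<in> V" for v
  proof -
    have "N v (h * real (Suc j)) \<in> measurable P (count_space UNIV)"
      "N v (h * real j) \<in> measurable P (count_space UNIV)"
      using h that by (intro N; simp)+
    then show ?thesis
      by (intro measurable_compose_countable[where g = "N v (h * real j)"
            and f = "\<lambda>i w. N v (h * real (Suc j)) w \<noteq> i"])
         (auto intro: measurable_compose)
  qed
  have nb: "v \<in> V" if "v \<in> E `` {x}" for v using that E by auto
  let ?X = "\<lambda>v w. discrete_meteor E (\<lambda>v t. N v t w) (\<lambda>v. M0 v w) h j v"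
  have "(\<lambda>w. if N v (h * real (Suc j)) w \<noteq> N v (h * real j) w
      then ?X v w / real (card (E `` {v})) else 0) \<in> borel_measurable P" if "v \<in> V" for v
    by (rule measurable_If[OF borel_measurable_divide[OF Suc.IH borel_measurable_const]
        borel_measurable_const pr[unfolded pred_def]]) (rule that)+
  then have "(\<lambda>w. ?X x w + (\<Sum>v\<in>E `` {x}. if N v (h * real (Suc j)) w \<noteq> N v (h * real j) w
      then ?X v w / real (card (E `` {v})) else 0)) \<in> borel_measurable P"
    using Suc nb by (intro borel_measurable_add borel_measurable_sum) auto
  from measurable_If[OF borel_measurable_const this pr[OF Suc.prems, unfolded pred_def]]
  show ?case by simp
qed (simp add: M0)

theorem proposition2p1:
  fixes V :: "'v set" and E :: "'v rel"
    and P :: "'w measure"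
    and N :: "'v \<Rightarrow> real \<Rightarrow> 'w \<Rightarrow> nat"
    and M0 :: "'v \<Rightarrow> 'w \<Rightarrow> real"
  assumes "E \<subseteq> V \<times> V" and "sym E" and "irrefl E"
    and "\<forall>u\<in>V. \<forall>v\<in>V. (u, v) \<in> E\<^sup>*"
    and "\<forall>v\<in>V. finite (E `` {v}) \<and> card (E `` {v}) \<ge> 1"
    and "bdd_above ((\<lambda>v. card (E `` {v})) ` V)"
    and "prob_space P"
    and "\<forall>v\<in>V. poisson_process P 1 (N v)"
    and "independent_processes P N V"
    and "\<forall>v\<in>V. M0 v \<in> borel_measurable P"
    and "AE w in P. \<forall>v\<in>V. 0 \<le> M0 v w"
  shows "\<exists>M. meteor_process P V E N M0 M \<and>
    (AE w in P. \<forall>m. meteor_path V E (\<lambda>v t. N v t w) (\<lambda>v. M0 v w) m \<longrightarrow>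
       (\<forall>v\<in>V. \<forall>t\<ge>0. m v t = M v t w))"
proof -
  \<comment> \<open>The limit is measurable for every \<open>w\<close>, with an arbitrary value where the schemes diverge.\<close>
  define M where "M v t w = meteor_mass E (\<lambda>v t. N v t w) (\<lambda>v. M0 v w) v t" for v t w
  have driver: "AE w in P. meteor_driver V E (\<lambda>v t. N v t w)"
    using assms by (intro prob_space.AE_meteor_driver) auto
  have path: "AE w in P. meteor_path V E (\<lambda>v t. N v t w) (\<lambda>v. M0 v w) (\<lambda>v t. M v t w)"
    using driver assms(11)
  proof eventually_elim
    case (elim w)
    then show ?case
      unfolding M_def by (intro meteor_driver.meteor_path_mass) auto
  qed
  have meas: "M v t \<in> borel_measurable P" if "v \<in> V" "0 \<le> t" for v t
    unfolding M_def meteor_mass_def meteor_mesh_def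
    using assms(1,8,10) that
    by (intro borel_measurable_lim_metric measurable_discrete_meteor) (auto simp: poisson_process_def)
  have "AE w in P. \<forall>m. meteor_path V E (\<lambda>v t. N v t w) (\<lambda>v. M0 v w) m \<longrightarrow>
       (\<forall>v\<in>V. \<forall>t\<ge>0. m v t = M v t w)"
    using driver path
  proof eventually_elim
    case (elim w)
    show ?case
    proof (intro allI impI ballI)
      fix m v and t :: real
      assume "meteor_path V E (\<lambda>v t. N v t w) (\<lambda>v. M0 v w) m" "v \<in> V" "0 \<le> t"
      then show "m v t = M v t w"
        by (rule meteor_driver.meteor_path_unique[OF elim(1) _ elim(2)])
    qed
  qed
  then show ?thesis
    using path meas by (intro exI[of _ M]) (simp add: meteor_process_def)
qed

end
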